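(* Let $\mathcal{A}$ be an algebra of operators acting in the linear space $\mathbb{P}$ of polynomials, and let $(p_n)_{n\ge 0}$ be a sequence of polynomials with $\deg p_n=n$. Assume that the $p_n$ are eigenfunctions of an operator $D_p\in\mathcal{A}$: there are numbers $\theta_n$ with $D_p(p_n)=\theta_np_n$, $n\ge 0$. Let $m\ge 1$ and let $(\varepsilon_n^h)_n$, $(\sigma_n^h)_n$, $h=1,\ldots,m$, be $m$ pairs of sequences of numbers, each sequence being a rational function in $n$, which define $m$ $\mathcal{D}$-operators $\mathcal{D}_1,\ldots,\mathcal{D}_m$ (not necessarily different) for $(p_n)_n$ and $\mathcal{A}$; that is, the operators defined by linearity from $$\mathcal{D}_h(p_n)=-\tfrac12\sigma_{n+1}^hp_n+\sum_{j=1}^n(-1)^{j+1}\sigma_{n-j+1}^h\,\varepsilon_n^h\cdots\varepsilon_{n-j+1}^h\,p_{n-j},\quad n\ge 0,$$ belong to $\mathcal{A}$. Let $Y_1,\ldots,Y_m$ be arbitrary polynomials such that $\Omega(n)\neq 0$ for all $n\ge 0$, where $$\Omega(x)=\det\left(\xi_{x-j,m-j}^lY_l(\theta_{x-j})\right)_{l,j=1}^m .$$ Consider the sequence of polynomials $(q_n)_{n\ge0}$ defined by $$q_n(x)=\begin{vmatrix} p_n(x)&-p_{n-1}(x)&\cdots&(-1)^mp_{n-m}(x)\\ \xi_{n,m}^1Y_1(\theta_n)&\xi_{n-1,m-1}^1Y_1(\theta_{n-1})&\cdots&Y_1(\theta_{n-m})\\ \vdots&\vdots&\ddots&\vdots\\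 \xi_{n,m}^mY_m(\theta_n)&\xi_{n-1,m-1}^mY_m(\theta_{n-1})&\cdots&Y_m(\theta_{n-m})\end{vmatrix}.$$ For a rational function $S$, let $\lambda_x$ be a function defined by $$\lambda_x-\lambda_{x-1}=S(x)\Omega(x),$$ and for $h=1,\ldots,m$ define $$M_h(x)=\sum_{j=1}^m(-1)^{h+j}\xi_{x,m-j}^h\,S(x+j)\det\left(\xi_{x+j-r,m-r}^{l}Y_l(\theta_{x+j-r})\right)_{l\in\mathbb{I}_h;\,r\in\mathbb{I}_j},$$ where $\mathbb{I}_h=\{1,2,\ldots,m\}\setminus\{h\}$. Assume the following: (i) $S(x)\Omega(x)$ is a polynomial in $x$; (ii) there exist polynomials $\tilde M_1,\ldots,\tilde M_m$ such that $M_h(x)=\sigma_{x+1}^h\tilde M_h(\theta_x)$, $h=1,\ldots,m$; (iii) there exists a polynomial $P_S$ such that $P_S(\theta_x)=2\lambda_x+\sum_{h=1}^mY_h(\theta_x)M_h(x)$. Then there exists an operator $D_{q,S}\in\mathcal{A}$ such that $$D_{q,S}(q_n)=\lambda_nq_n,\quad n\ge 0.$$ Moreover, $D_{q,S}$ is defined by $$D_{q,S}=\tfrac12P_S(D_p)+\sum_{h=1}^m\tilde M_h(D_p)\,\mathcal{D}_h\,Y_h(D_p).$$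
   Context: $\mathbb{P}$ is the linear space of polynomials in one variable; operators act linearly $\mathbb{P}\to\mathbb{P}$; algebras of operators are taken with composition and contain the identity. For an operator $D$ and a polynomial $P(x)=\sum_{j=0}^ka_jx^j$, $P(D)=\sum_{j=0}^ka_jD^j$. Products such as $\tilde M_h(D_p)\mathcal{D}_hY_h(D_p)$ are compositions ($Y_h(D_p)$ is applied first). Conventions: $p_k=0$ for $k<0$. The sequences $\varepsilon_n^h,\sigma_n^h$, being rational functions of $n$, are extended to functions $\varepsilon_x^h,\sigma_x^h$ of $x$; likewise $\theta_x$ denotes a given function of $x$ extending the sequence $(\theta_n)_n$ (no other constraint is placed on it). The values at integers appearing in the formulas are assumed to be defined. For $h=1,\ldots,m$ the auxiliary functions $\xi_{x,i}^h$ are $$\xi_{x,i}^h=\prod_{j=0}^{i-1}\varepsilon_{x-j}^h\ (i\ge1),\qquad \xi_{x,0}^h=1,\qquad \xi_{x,i}^h=\frac1{\xi_{x-i,-i}^h}\ (i\le-1).$$ *)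

theory Defs
  imports
    "HOL-Computational_Algebra.Polynomial"
    "HOL-Computational_Algebra.Fraction_Field"
    "Jordan_Normal_Form.Determinant"
begin

text \<open>
  A rational function is an element of the fraction field of the polynomials. It is defined
  at \<open>x\<close> if it has a representation whose denominator does not vanish at \<open>x\<close>; the value does
  not depend on that representation (lemma \<open>rf_eval_Fract\<close>). At a pole \<open>rf_eval\<close> is
  unspecified.
\<close>

definition rf_defined_at :: "'a::field poly fract \<Rightarrow> 'a \<Rightarrow> bool" where
  "rf_defined_at f x \<longleftrightarrow> (\<exists>a b. poly b x \<noteq> 0 \<and> f = Fract a b)"

definition rf_eval :: "'a::field poly fract \<Rightarrow> 'a \<Rightarrow> 'a" where
  "rf_eval f x = (THE y. \<exists>a b. poly b x \<noteq> 0 \<and> f = Fract a b \<and> y = poly a x / poly b x)"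

lemma rf_eval_Fract:
  assumes "poly b x \<noteq> 0"
  shows "rf_eval (Fract a b) x = poly a x / poly b x"
  unfolding rf_eval_def
proof (rule the_equality)
  show "\<exists>a' b'. poly b' x \<noteq> 0 \<and> Fract a b = Fract a' b' \<and> poly a x / poly b x = poly a' x / poly b' x"
    using assms by blast
next
  fix y
  assume "\<exists>a' b'. poly b' x \<noteq> 0 \<and> Fract a b = Fract a' b' \<and> y = poly a' x / poly b' x"
  then obtain a' b' where b': "poly b' x \<noteq> 0" and eq: "Fract a b = Fract a' b'"
    and y: "y = poly a' x / poly b' x" by blast
  have "b \<noteq> 0" "b' \<noteq> 0" using assms b' by auto
  with eq have "a * b' = a' * b" by (simp add: eq_fract)
  then have "poly a x * poly b' x = poly a' x * poly b x" by (metis poly_mult)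
  with assms b' show "y = poly a x / poly b x" unfolding y by (simp add: field_simps)
qed

definition operator_algebra :: "('a::field poly \<Rightarrow> 'a poly) set \<Rightarrow> bool" where
  "operator_algebra A \<longleftrightarrow>
     (\<forall>T\<in>A. Vector_Spaces.linear smult smult T) \<and>
     id \<in> A \<and>
     (\<forall>T\<in>A. \<forall>U\<in>A. (\<lambda>f. T f + U f) \<in> A) \<and>
     (\<forall>c. \<forall>T\<in>A. (\<lambda>f. smult c (T f)) \<in> A) \<and>
     (\<forall>T\<in>A. \<forall>U\<in>A. T \<circ> U \<in> A)"

definition op_poly :: "'a::field poly \<Rightarrow> ('a poly \<Rightarrow> 'a poly) \<Rightarrow> 'a poly \<Rightarrow> 'a poly" where
  "op_poly P T f = (\<Sum>j\<le>degree P. smult (coeff P j) ((T ^^ j) f))"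

text \<open>
  The operator is unique if \<open>degree (p n) = n\<close> and \<open>p n \<noteq> 0\<close> for all \<open>n\<close>, since the \<open>p n\<close>
  are then a basis.
\<close>

definition is_D_operator ::
  "('a::field poly \<Rightarrow> 'a poly) set \<Rightarrow> (nat \<Rightarrow> 'a poly) \<Rightarrow> 'a poly fract \<Rightarrow> 'a poly fract
     \<Rightarrow> ('a poly \<Rightarrow> 'a poly) \<Rightarrow> bool" where
  "is_D_operator A p \<epsilon> \<sigma> T \<longleftrightarrow>
     Vector_Spaces.linear smult smult T \<and>
     (\<forall>n. T (p n) =
        smult (- (1/2) * rf_eval \<sigma> (of_nat (n + 1))) (p n)
        + (\<Sum>j=1..n. smult ((-1) ^ (j + 1) * rf_eval \<sigma> (of_nat (n - j + 1))
                             * (\<Prod>i<j. rf_eval \<epsilon> (of_nat (n - i)))) (p (n - j)))) \<and>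
     T \<in> A"

definition xi :: "'a::field poly fract \<Rightarrow> 'a \<Rightarrow> int \<Rightarrow> 'a" where
  "xi \<epsilon> x i =
     (if i \<ge> 0 then \<Prod>j<nat i. rf_eval \<epsilon> (x - of_nat j)
      else 1 / (\<Prod>j<nat (- i). rf_eval \<epsilon> (x - of_int i - of_nat j)))"

text \<open>
  Matrices are indexed from 0, whereas \<open>\<epsilon>\<close> and \<open>Y\<close> are indexed by \<open>{1..m}\<close>: row \<open>a\<close>, column
  \<open>b\<close> of \<open>Omega_mat\<close> is the entry for \<open>l = a + 1\<close>, \<open>j = b + 1\<close>.
\<close>

definition Omega_mat ::
  "nat \<Rightarrow> (nat \<Rightarrow> 'a::field poly fract) \<Rightarrow> (nat \<Rightarrow> 'a poly) \<Rightarrow> ('a \<Rightarrow> 'a) \<Rightarrow> 'a \<Rightarrow> 'a mat" where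
  "Omega_mat m \<epsilon> Y \<theta> x = mat m m (\<lambda>(a, b). let l = a + 1; j = b + 1 in
     xi (\<epsilon> l) (x - of_nat j) (int m - int j) * poly (Y l) (\<theta> (x - of_nat j)))"

definition Omega ::
  "nat \<Rightarrow> (nat \<Rightarrow> 'a::field poly fract) \<Rightarrow> (nat \<Rightarrow> 'a poly) \<Rightarrow> ('a \<Rightarrow> 'a) \<Rightarrow> 'a \<Rightarrow> 'a" where
  "Omega m \<epsilon> Y \<theta> x = det (Omega_mat m \<epsilon> Y \<theta> x)"

definition q_poly ::
  "nat \<Rightarrow> (nat \<Rightarrow> 'a::field poly) \<Rightarrow> (nat \<Rightarrow> 'a poly fract) \<Rightarrow> (nat \<Rightarrow> 'a poly) \<Rightarrow> ('a \<Rightarrow> 'a)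
     \<Rightarrow> nat \<Rightarrow> 'a poly" where
  "q_poly m p \<epsilon> Y \<theta> n = det (mat (m + 1) (m + 1) (\<lambda>(l, j).
     if l = 0 then (-1) ^ j * (if j \<le> n then p (n - j) else 0)
     else [: xi (\<epsilon> l) (of_nat n - of_nat j) (int m - int j)
             * poly (Y l) (\<theta> (of_nat n - of_nat j)) :]))"

text \<open>
  The determinant over \<open>l \<noteq> h\<close>, \<open>r \<noteq> j\<close> of the entries
  \<open>\<xi>\<^sup>l\<^bsub>x+j-r,m-r\<^esub> Y\<^sub>l(\<theta>\<^bsub>x+j-r\<^esub>)\<close> is the minor of the matrix of \<open>\<Omega>(x+j)\<close> obtained by deleting
  row \<open>h\<close> and column \<open>j\<close>.
\<close>

definition M_fun ::
  "nat \<Rightarrow> (nat \<Rightarrow> 'a::field poly fract) \<Rightarrow> (nat \<Rightarrow> 'a poly) \<Rightarrow> ('a \<Rightarrow> 'a) \<Rightarrow> 'a poly fract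
     \<Rightarrow> nat \<Rightarrow> 'a \<Rightarrow> 'a" where
  "M_fun m \<epsilon> Y \<theta> S h x =
     (\<Sum>j=1..m. (-1) ^ (h + j) * xi (\<epsilon> h) x (int m - int j) * rf_eval S (x + of_nat j)
        * det (mat_delete (Omega_mat m \<epsilon> Y \<theta> (x + of_nat j)) (h - 1) (j - 1)))"

text \<open>
  Identities between functions of \<open>x\<close> are meant at the points where the rational functions
  occurring in them have no pole. The values of \<open>\<epsilon>\<close> occurring in \<open>\<Omega>(x)\<close> are those at
  \<open>x - 1, \<dots>, x - (m - 1)\<close>; those in the factors \<open>\<xi>\<^sup>h\<^bsub>x,m-j\<^esub>\<close> of \<open>M\<^sub>h(x)\<close>, at
  \<open>x, \<dots>, x - (m - 2)\<close>, already occur in \<open>\<Omega>(x + 1)\<close>.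
\<close>

definition SOmega_defined_at ::
  "nat \<Rightarrow> (nat \<Rightarrow> 'a::field poly fract) \<Rightarrow> 'a poly fract \<Rightarrow> 'a \<Rightarrow> bool" where
  "SOmega_defined_at m \<epsilon> S x \<longleftrightarrow>
     rf_defined_at S x \<and> (\<forall>l\<in>{1..m}. \<forall>i\<in>{1..<m}. rf_defined_at (\<epsilon> l) (x - of_nat i))"

definition M_defined_at ::
  "nat \<Rightarrow> (nat \<Rightarrow> 'a::field poly fract) \<Rightarrow> 'a poly fract \<Rightarrow> 'a \<Rightarrow> bool" where
  "M_defined_at m \<epsilon> S x \<longleftrightarrow> (\<forall>j\<in>{1..m}. SOmega_defined_at m \<epsilon> S (x + of_nat j))"

end

theory Submission
  imports Defs
begin

text \<open>
  Expanding along the first row, \<open>q\<^sub>n = \<Sum>\<^sub>j \<beta>\<^sub>j p\<^bsub>n-j\<^esub>\<close>, where the \<open>\<beta>\<^sub>j\<close> are the maximal minors of the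
  remaining \<open>m\<close> rows. By (ii) and (iii) the operator acts triangularly:
  \<open>p\<^sub>k\<close> goes to \<open>\<lambda>\<^sub>k p\<^sub>k\<close> plus multiples of the \<open>p\<^sub>r\<close> with \<open>r < k\<close>, whose coefficients are
  \<open>\<plusminus>\<Sum>\<^sub>h \<xi>\<^sup>h\<^bsub>k,k-r\<^esub> Y\<^sub>h(\<theta>\<^sub>k) M\<^sub>h(r)\<close>. Inserting the definition of \<open>M\<^sub>h\<close>, the sum over \<open>h\<close> is the Laplace
  expansion of \<open>\<Omega>(r + j)\<close> with its \<open>j\<close>-th column replaced by the column belonging to \<open>k\<close>. The
  alternating sum of all columns with weights \<open>\<beta>\<^sub>j\<close> vanishes (a determinant with a repeated row),
  so in the coefficient of \<open>p\<^sub>r\<close> in the image of \<open>q\<^sub>n\<close> these determinants add up to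
  \<open>\<beta>\<^bsub>n-r\<^esub> \<Sum>\<^sub>j S(r + j) \<Omega>(r + j) = \<beta>\<^bsub>n-r\<^esub> (\<lambda>\<^sub>n - \<lambda>\<^sub>r)\<close>. Changing the last index of \<open>\<xi>\<close> only multiplies a row
  by a factor, which avoids dividing by values of \<open>\<epsilon>\<close>.
\<close>

section \<open>Cofactor sums and replaced columns\<close>

text \<open>The two matrices differ only in column \<open>j\<close>, which is deleted in every
  cofactor along that column.\<close>

lemma sum_cofactor_column_mult:
  fixes B :: "'a::comm_ring_1 mat"
  assumes B: "B \<in> carrier_mat m m" and j: "j < m"
  shows "(\<Sum>i<m. cofactor B i j * u i) = det (mat m m (\<lambda>(i, c). if c = j then u i else B $$ (i, c)))"
proof -
  let ?C = "mat m m (\<lambda>(i, c). if c = j then u i else B $$ (i, c))"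
  have "mat_delete ?C i j = mat_delete B i j" if "i < m" for i
    using B that j by (intro eq_matI) (auto simp: mat_delete_def)
  then have "cofactor ?C i j = cofactor B i j" if "i < m" for i
    using that by (simp add: cofactor_def)
  with laplace_expansion_column[of ?C m j] j show ?thesis
    by (simp add: mult.commute)
qed

lemma sum_cofactor_same_column:
  fixes B :: "'a::comm_ring_1 mat"
  assumes B: "B \<in> carrier_mat m m" and j: "j < m" and u: "\<And>i. i < m \<Longrightarrow> u i = B $$ (i, j)"
  shows "(\<Sum>i<m. cofactor B i j * u i) = det B"
proof -
  have "mat m m (\<lambda>(i, c). if c = j then u i else B $$ (i, c)) = B"
    using B u by (intro eq_matI) auto
  with sum_cofactor_column_mult[OF B j] show ?thesis by simp
qed

lemma sum_cofactor_other_column: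
  fixes B :: "'a::comm_ring_1 mat"
  assumes B: "B \<in> carrier_mat m m" and j: "j < m" and c: "c < m" "c \<noteq> j"
    and u: "\<And>i. i < m \<Longrightarrow> u i = B $$ (i, c)"
  shows "(\<Sum>i<m. cofactor B i j * u i) = 0"
  unfolding sum_cofactor_column_mult[OF B j]
  by (rule det_identical_columns[of _ m j c]) (use j c u in \<open>auto intro!: eq_vecI simp: col_def\<close>)

section \<open>Casorati matrices and linear relations between their columns\<close>

context
  fixes m :: nat and e y :: "nat \<Rightarrow> int \<Rightarrow> 'a::comm_ring_1"
begin

text \<open>\<open>col_entry b k a\<close> is \<open>\<xi>\<^bsub>k,k-b\<^esub> Y(\<theta>\<^sub>k)\<close> for the index \<open>a + 1\<close>; junk if \<open>k < b\<close>.\<close>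

definition col_entry :: "int \<Rightarrow> int \<Rightarrow> nat \<Rightarrow> 'a" where
  "col_entry b k a = (\<Prod>i<nat (k - b). e a (k - int i)) * y a k"

text \<open>This is the matrix of Omega at an integer \<open>x\<close>: its columns belong to
  \<open>x - 1, ..., x - m\<close> and share the base \<open>x - m\<close>.\<close>

definition casorati :: "int \<Rightarrow> 'a mat" where
  "casorati x = mat m m (\<lambda>(a, c). col_entry (x - int m) (x - 1 - int c) a)"

text \<open>The array with columns for \<open>n, ..., n - m\<close> and base \<open>n - m\<close>,
  with column \<open>j\<close> skipped by the conditional. It will be the coefficient of
  \<open>p (n - j)\<close> in q_n.\<close>

definition casorati_minor :: "int \<Rightarrow> nat \<Rightarrow> 'a" where
  "casorati_minor n j = det (mat m m (\<lambda>(a, c). col_entry (n - int m) (n - int (if c < j then c else Suc c)) a))"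

lemma casorati_carrier [simp]: "casorati x \<in> carrier_mat m m"
  by (simp add: casorati_def)

lemma prod_shift_split:
  fixes f :: "int \<Rightarrow> 'a"
  assumes "c \<le> b" "b \<le> k"
  shows "(\<Prod>i<nat (k - c). f (k - int i)) = (\<Prod>i<nat (k - b). f (k - int i)) * (\<Prod>i<nat (b - c). f (b - int i))"
proof -
  define s t where "s = nat (k - b)" and "t = nat (b - c)"
  have s: "b = k - int s" and t: "c = k - int s - int t" using assms by (auto simp: s_def t_def)
  have "(\<Prod>i<s + r. f (k - int i)) = (\<Prod>i<s. f (k - int i)) * (\<Prod>i<r. f (k - int s - int i))" for r
    by (induction r) (simp_all add: algebra_simps)
  moreover have "nat (k - c) = s + t" "nat (k - b) = s" "nat (b - c) = t"
    using s t by auto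
  ultimately show ?thesis by (simp add: s)
qed

text \<open>Lowering the base appends the values of \<open>e a\<close> at
  \<open>b, ..., c + 1\<close>. They do not depend on \<open>k\<close>, so a whole row is scaled by
  one factor.\<close>

lemma col_entry_rebase:
  assumes "c \<le> b" "b \<le> k"
  shows "col_entry c k a = (\<Prod>i<nat (b - c). e a (b - int i)) * col_entry b k a"
  unfolding col_entry_def prod_shift_split[OF assms] by (simp add: mult_ac)

lemma det_expand_first_row:
  fixes r :: "nat \<Rightarrow> 'b::comm_ring_1"
  shows "det (mat (m + 1) (m + 1) (\<lambda>(l, j). if l = 0 then r j else w l j))
    = (\<Sum>j\<le>m. (-1) ^ j * r j * det (mat m m (\<lambda>(a, c). w (Suc a) (if c < j then c else Suc c))))"
proof -
  let ?Q = "mat (m + 1) (m + 1) (\<lambda>(l, j). if l = 0 then r j else w l j)"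
  have "mat_delete ?Q 0 j = mat m m (\<lambda>(a, c). w (Suc a) (if c < j then c else Suc c))" if "j \<le> m" for j
    using that by (intro eq_matI) (auto simp: mat_delete_def)
  moreover have "det ?Q = (\<Sum>j<m + 1. ?Q $$ (0, j) * cofactor ?Q 0 j)"
    by (rule laplace_expansion_row) auto
  ultimately show ?thesis
    by (simp add: cofactor_def mult_ac lessThan_Suc_atMost)
qed

text \<open>Repeat a row of the \<open>m\<close> by \<open>m + 1\<close> array on top of it.\<close>

lemma casorati_minor_relation:
  assumes a: "a < m"
  shows "(\<Sum>j\<le>m. (-1) ^ j * casorati_minor n j * col_entry (n - int m) (n - int j) a) = 0"
proof -
  let ?w = "\<lambda>l j. col_entry (n - int m) (n - int j) (l - 1)"
  let ?Q = "mat (m + 1) (m + 1) (\<lambda>(l, j). if l = 0 then ?w (Suc a) j else ?w l j)"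
  have "det ?Q = 0"
    by (rule det_identical_rows[of _ "m + 1" 0 "Suc a"]) (use a in \<open>auto intro!: eq_vecI simp: row_def\<close>)
  then show ?thesis
    unfolding det_expand_first_row by (simp add: casorati_minor_def mult_ac)
qed

text \<open>As \<open>b\<close> lies below all the indices \<open>n - j\<close>, the change of base
  multiplies the known relation by a factor common to all columns. Nothing is divided, so this
  factor may vanish.\<close>

lemma casorati_minor_relation_rebase:
  assumes a: "a < m" and b: "b \<le> n - int m"
  shows "(\<Sum>j\<le>m. (-1) ^ j * casorati_minor n j * col_entry b (n - int j) a) = 0"
proof -
  have "(\<Sum>j\<le>m. (-1) ^ j * casorati_minor n j * col_entry b (n - int j) a)
    = (\<Prod>i<nat (n - int m - b). e a (n - int m - int i))
      * (\<Sum>j\<le>m. (-1) ^ j * casorati_minor n j * col_entry (n - int m) (n - int j) a)"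
    unfolding sum_distrib_left
    by (rule sum.cong) (auto simp: col_entry_rebase[OF b] mult_ac)
  with casorati_minor_relation[OF a] show ?thesis by simp
qed

lemma cofactor_col_entry_zero:
  assumes "j < m" "c < m" "c \<noteq> j"
  shows "(\<Sum>a<m. cofactor (casorati x) a j * col_entry (x - int m) (x - 1 - int c) a) = 0"
  by (rule sum_cofactor_other_column[of _ m _ c]) (use assms in \<open>auto simp: casorati_def\<close>)

lemma cofactor_col_entry_det:
  assumes "j < m"
  shows "(\<Sum>a<m. cofactor (casorati x) a j * col_entry (x - int m) (x - 1 - int j) a) = det (casorati x)"
  by (rule sum_cofactor_same_column) (use assms in \<open>auto simp: casorati_def\<close>)

text \<open>Column \<open>j\<close> of \<open>casorati x\<close> belongs to \<open>n - t\<close>;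
  the inner sum is the determinant with the column of \<open>n - i\<close> put in its place. For
  \<open>j < t\<close> the sum over all \<open>i <= m\<close> vanishes, and so does each term with
  \<open>i > t\<close>; hence the part below \<open>t\<close> is minus the term
  \<open>i = t\<close>.\<close>

lemma casorati_minor_cofactor_sum:
  assumes t: "t \<le> m" and j: "j < m" and x: "x = n - int t + 1 + int j"
  shows "(\<Sum>i<t. (-1) ^ i * casorati_minor n i
        * (\<Sum>a<m. cofactor (casorati x) a j * col_entry (x - int m) (n - int i) a))
    = (if j < t then - ((-1) ^ t * casorati_minor n t * det (casorati x)) else 0)"
proof -
  define F where "F i = (\<Sum>a<m. cofactor (casorati x) a j * col_entry (x - int m) (n - int i) a)" for i
  \<comment> \<open>Under these bounds \<open>n - i\<close> belongs to a column of
    \<open>casorati x\<close> other than the \<open>j\<close>-th, at position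
    \<open>i + j - t\<close>.\<close>
  have F0: "F i = 0" if "i \<noteq> t" "int t \<le> int i + int j" "int i + int j < int t + int m" for i
  proof -
    have eq: "n - int i = x - 1 - int (i + j - t)" using that x by simp
    show ?thesis
      unfolding F_def eq by (rule cofactor_col_entry_zero) (use that j in auto)
  qed
  show ?thesis
  proof (cases "j < t")
    case False
    then have "F i = 0" if "i < t" for i
      using F0[of i] that j t by simp
    then show ?thesis using False by (simp add: F_def[symmetric])
  next
    case True
    have eq: "n - int t = x - 1 - int j" using x by simp
    have Ft: "F t = det (casorati x)"
      unfolding F_def eq by (rule cofactor_col_entry_det[OF j])
    \<comment> \<open>The relation needs a base that is at most \<open>n - m\<close>; this is where
      \<open>j < t\<close> enters.\<close>
    have b: "x - int m \<le> n - int m" using x True by simp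
    have "(\<Sum>i\<le>m. (-1) ^ i * casorati_minor n i * F i)
      = (\<Sum>a<m. cofactor (casorati x) a j
          * (\<Sum>i\<le>m. (-1) ^ i * casorati_minor n i * col_entry (x - int m) (n - int i) a))"
      unfolding F_def sum_distrib_left by (subst sum.swap) (simp add: mult_ac)
    also have "\<dots> = 0" by (simp add: casorati_minor_relation_rebase[OF _ b])
    finally have all: "(\<Sum>i\<le>m. (-1) ^ i * casorati_minor n i * F i) = 0" .
    have "(\<Sum>i\<le>m. (-1) ^ i * casorati_minor n i * F i) = (\<Sum>i\<le>t. (-1) ^ i * casorati_minor n i * F i)"
      using t True F0 by (intro sum.mono_neutral_right) auto
    also have "\<dots> = (\<Sum>i<t. (-1) ^ i * casorati_minor n i * F i) + (-1) ^ t * casorati_minor n t * F t"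
      by (simp add: lessThan_Suc_atMost[symmetric])
    finally show ?thesis
      using True all Ft by (simp add: F_def[symmetric] eq_neg_iff_add_eq_0)
  qed
qed

section \<open>The functions M_h at integers and the coefficients of q_n\<close>

context
  fixes s :: "int \<Rightarrow> 'a"
begin

text \<open>Here h is \<open>a + 1\<close> and the summation index is lowered by one. The sign of
  each summand is contained in the cofactor.\<close>

definition M_int :: "nat \<Rightarrow> int \<Rightarrow> 'a" where
  "M_int a k = (\<Sum>j<m. (\<Prod>i<m - 1 - j. e a (k - int i)) * s (k + 1 + int j)
     * cofactor (casorati (k + 1 + int j)) a j)"

text \<open>The product of values of \<open>e\<close> in each summand of \<open>M_int\<close> is
  exactly the factor that lowers the base from \<open>n - t\<close> to that of the Casorati matrix
  in the same summand. After interchanging sums, \<open>casorati_minor_cofactor_sum\<close> leaves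
  only the \<open>j < t\<close>.\<close>

lemma casorati_minor_M_sum:
  assumes t: "t \<le> m"
  shows "(\<Sum>i<t. (-1) ^ i * casorati_minor n i * (\<Sum>a<m. col_entry (n - int t) (n - int i) a * M_int a (n - int t)))
    = - ((-1) ^ t * casorati_minor n t * (\<Sum>j<t. s (n - int t + 1 + int j) * det (casorati (n - int t + 1 + int j))))"
proof -
  let ?x = "\<lambda>j. n - int t + 1 + int j"
  have inner: "(\<Sum>a<m. col_entry (n - int t) (n - int i) a * M_int a (n - int t))
    = (\<Sum>j<m. s (?x j) * (\<Sum>a<m. cofactor (casorati (?x j)) a j * col_entry (?x j - int m) (n - int i) a))"
    if i: "i < t" for i
  proof -
    have "col_entry (?x j - int m) (n - int i) a
      = (\<Prod>q<m - 1 - j. e a (n - int t - int q)) * col_entry (n - int t) (n - int i) a" if "j < m" for j a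
    proof -
      have "nat (n - int t - (?x j - int m)) = m - 1 - j" using that by simp
      then show ?thesis
        using col_entry_rebase[of "?x j - int m" "n - int t" "n - int i" a] that i by simp
    qed
    then show ?thesis
      unfolding M_int_def sum_distrib_left
      by (subst sum.swap) (intro sum.cong refl, simp add: mult_ac)
  qed
  have "(\<Sum>i<t. (-1) ^ i * casorati_minor n i * (\<Sum>a<m. col_entry (n - int t) (n - int i) a * M_int a (n - int t)))
    = (\<Sum>i<t. \<Sum>j<m. s (?x j) * ((-1) ^ i * casorati_minor n i
        * (\<Sum>a<m. cofactor (casorati (?x j)) a j * col_entry (?x j - int m) (n - int i) a)))"
    by (intro sum.cong refl) (simp only: inner lessThan_iff, simp add: sum_distrib_left mult_ac)
  also have "\<dots> = (\<Sum>j<m. s (?x j) * (\<Sum>i<t. (-1) ^ i * casorati_minor n i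
        * (\<Sum>a<m. cofactor (casorati (?x j)) a j * col_entry (?x j - int m) (n - int i) a)))"
    by (subst sum.swap) (simp add: sum_distrib_left)
  also have "\<dots> = (\<Sum>j<m. s (?x j) * (if j < t then - ((-1) ^ t * casorati_minor n t * det (casorati (?x j))) else 0))"
    by (intro sum.cong refl) (simp add: casorati_minor_cofactor_sum[OF t _ refl])
  also have "\<dots> = (\<Sum>j<t. s (?x j) * - ((-1) ^ t * casorati_minor n t * det (casorati (?x j))))"
    using t by (intro sum.mono_neutral_cong_right) auto
  finally show ?thesis
    by (simp add: sum_distrib_left sum_negf mult_ac)
qed

text \<open>Only \<open>p n, ..., p (n - m)\<close> occur in q_n, whence the cutoff. The value is
  meaningful for \<open>k <= n\<close>.\<close>

definition q_coeff :: "nat \<Rightarrow> nat \<Rightarrow> 'a" where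
  "q_coeff n k = (if n \<le> k + m then casorati_minor (int n) (n - k) else 0)"

definition lower_coeff :: "nat \<Rightarrow> nat \<Rightarrow> 'a" where
  "lower_coeff k r = (-1) ^ (k + r + 1) * (\<Sum>a<m. col_entry (int r) (int k) a * M_int a (int r))"

text \<open>Both sides are the coefficients of \<open>p r\<close> in the eigenvalue equation for
  q_n. With \<open>t = n - r\<close>, the case \<open>t <= m\<close> reduces to a telescoping sum of
  \<open>lam\<close>; otherwise \<open>p r\<close> does not occur in q_n and the lower terms must
  cancel.\<close>

lemma q_coeff_eigen:
  assumes lam: "\<And>k. lam (Suc k) - lam k = s (int k + 1) * det (casorati (int k + 1))"
    and r: "r \<le> n"
  shows "q_coeff n r * lam r + (\<Sum>k\<in>{r<..n}. q_coeff n k * lower_coeff k r) = lam n * q_coeff n r"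
proof -
  define t where "t = n - r"
  define H where "H i = (\<Sum>a<m. col_entry (int r) (int n - int i) a * M_int a (int r))" for i
  have t: "n = r + t" "int r = int n - int t" using r by (auto simp: t_def)
  have term_eq: "q_coeff n (n - i) * lower_coeff (n - i) r
      = - ((-1) ^ t * ((-1) ^ i * (if i \<le> m then casorati_minor (int n) i else 0) * H i))" if "i < t" for i
  proof -
    \<comment> \<open>The exponent is \<open>2 * r + t - i\<close>.\<close>
    have "even (n - i + r) \<longleftrightarrow> even (t + i)" using that t(1) by presburger
    then have "(-1 :: 'a) ^ (n - i + r) = (-1) ^ (t + i)" by (simp add: minus_one_power_iff)
    then have sign: "(-1 :: 'a) ^ (n - i + r + 1) = - ((-1) ^ t * (-1) ^ i)"
      by (simp add: power_add)
    have "q_coeff n (n - i) = (if i \<le> m then casorati_minor (int n) i else 0)"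
      using that t(1) by (auto simp: q_coeff_def)
    moreover have "int (n - i) = int n - int i" using that t(1) by simp
    ultimately show ?thesis
      unfolding lower_coeff_def sign H_def by (simp add: mult_ac)
  qed
  have "(\<Sum>k\<in>{r<..n}. q_coeff n k * lower_coeff k r) = (\<Sum>i<t. q_coeff n (n - i) * lower_coeff (n - i) r)"
    by (rule sum.reindex_bij_witness[of _ "\<lambda>i. n - i" "\<lambda>k. n - k"]) (use t in auto)
  also have "\<dots> = - ((-1) ^ t * (\<Sum>i<t. (-1) ^ i * (if i \<le> m then casorati_minor (int n) i else 0) * H i))"
    by (simp add: term_eq sum_negf sum_distrib_left)
  finally have sum_eq: "(\<Sum>k\<in>{r<..n}. q_coeff n k * lower_coeff k r) = \<dots>" .
  show ?thesis
  proof (cases "t \<le> m")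
    case True
    have "(\<Sum>i<t. (-1) ^ i * (if i \<le> m then casorati_minor (int n) i else 0) * H i)
      = (\<Sum>i<t. (-1) ^ i * casorati_minor (int n) i * H i)"
      using True by (intro sum.cong) auto
    also have "\<dots> = - ((-1) ^ t * casorati_minor (int n) t
        * (\<Sum>j<t. s (int r + 1 + int j) * det (casorati (int r + 1 + int j))))"
      unfolding H_def t(2) by (rule casorati_minor_M_sum[OF True])
    also have "(\<Sum>j<t. s (int r + 1 + int j) * det (casorati (int r + 1 + int j)))
      = (\<Sum>j<t. lam (r + Suc j) - lam (r + j))"
      using lam by (intro sum.cong refl) (simp add: algebra_simps)
    also have "\<dots> = lam n - lam r"
      using sum_lessThan_telescope[of "\<lambda>j. lam (r + j)" t] by (simp add: t(1))
    finally have "(\<Sum>k\<in>{r<..n}. q_coeff n k * lower_coeff k r) = casorati_minor (int n) t * (lam n - lam r)"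
      unfolding sum_eq by (simp add: minus_one_power_iff)
    moreover have "q_coeff n r = casorati_minor (int n) t" using True t(1) by (simp add: q_coeff_def)
    ultimately show ?thesis by (simp add: algebra_simps)
  next
    case False
    have "(\<Sum>i<t. (-1) ^ i * (if i \<le> m then casorati_minor (int n) i else 0) * H i)
      = (\<Sum>i\<le>m. (-1) ^ i * casorati_minor (int n) i * H i)"
      using False by (intro sum.mono_neutral_cong_right) auto
    \<comment> \<open>Since \<open>r < n - m\<close>, all \<open>m + 1\<close> columns can be taken
      with base \<open>r\<close>, and their relation makes each inner sum zero.\<close>
    also have "\<dots> = (\<Sum>a<m. M_int a (int r)
        * (\<Sum>i\<le>m. (-1) ^ i * casorati_minor (int n) i * col_entry (int r) (int n - int i) a))"
      unfolding H_def sum_distrib_left by (subst sum.swap) (simp add: mult_ac)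
    also have "\<dots> = 0"
      using False t by (simp add: casorati_minor_relation_rebase)
    finally have "(\<Sum>k\<in>{r<..n}. q_coeff n k * lower_coeff k r) = 0"
      unfolding sum_eq by simp
    moreover have "q_coeff n r = 0" using False t by (simp add: q_coeff_def)
    ultimately show ?thesis by simp
  qed
qed

end

end


section \<open>Operator algebras and triangular operators\<close>

lemma op_alg_linear:
  assumes "operator_algebra A" "T \<in> A"
  shows "module_hom smult smult T"
  using assms by (simp add: operator_algebra_def linear_iff_module_hom)

lemma op_alg_add: "operator_algebra A \<Longrightarrow> T \<in> A \<Longrightarrow> U \<in> A \<Longrightarrow> (\<lambda>f. T f + U f) \<in> A"
  by (simp add: operator_algebra_def)

lemma op_alg_smult: "operator_algebra A \<Longrightarrow> T \<in> A \<Longrightarrow> (\<lambda>f. smult c (T f)) \<in> A"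
  by (simp add: operator_algebra_def)

lemma op_alg_comp: "operator_algebra A \<Longrightarrow> T \<in> A \<Longrightarrow> U \<in> A \<Longrightarrow> (\<lambda>f. T (U f)) \<in> A"
  by (simp add: operator_algebra_def comp_def)

lemma op_alg_funpow:
  assumes "operator_algebra A" "T \<in> A"
  shows "T ^^ j \<in> A"
  using assms by (induction j) (auto simp: operator_algebra_def)

lemma op_alg_sum:
  assumes A: "operator_algebra A" and F: "\<And>j. j \<in> I \<Longrightarrow> F j \<in> A"
  shows "(\<lambda>f. \<Sum>j\<in>I. F j f) \<in> A"
proof -
  \<comment> \<open>Empty sums require the zero operator, obtained as \<open>0\<close> times the
    identity.\<close>
  have zero: "(\<lambda>f. 0) \<in> A"
    using op_alg_smult[OF A, of id 0] A by (simp add: operator_algebra_def)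
  show ?thesis
    using F by (induction I rule: infinite_finite_induct) (simp_all add: zero op_alg_add[OF A])
qed

lemma op_alg_op_poly:
  assumes A: "operator_algebra A" and T: "T \<in> A"
  shows "op_poly P T \<in> A"
  unfolding op_poly_def[abs_def]
  by (intro op_alg_sum op_alg_smult op_alg_funpow A T)

lemma op_poly_eigen:
  assumes T: "module_hom smult smult T" and f: "T f = smult c f"
  shows "op_poly P T f = smult (poly P c) f"
proof -
  interpret module_hom smult smult T by fact
  have "(T ^^ j) f = smult (c ^ j) f" for j
    by (induction j) (simp_all add: scale f mult.commute)
  then show ?thesis
    by (simp add: op_poly_def poly_altdef smult_sum)
qed

lemma smult_sum_right: "smult c (\<Sum>i\<in>I. f i) = (\<Sum>i\<in>I. smult c (f i))"
  by (induction I rule: infinite_finite_induct) (simp_all add: smult_add_right)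

text \<open>Summing over the pairs \<open>r < k <= n\<close> by \<open>r\<close> first collects the
  coefficient of \<open>p r\<close>, which assumption \<open>b\<close> evaluates.\<close>

lemma triangular_eigenvector:
  fixes p :: "nat \<Rightarrow> 'a::field poly"
  assumes T: "module_hom smult smult T"
    and Tp: "\<And>k. T (p k) = smult (l k) (p k) + (\<Sum>r<k. smult (G k r) (p r))"
    and b: "\<And>r. r \<le> n \<Longrightarrow> b r * l r + (\<Sum>k\<in>{r<..n}. b k * G k r) = L * b r"
  shows "T (\<Sum>k\<le>n. smult (b k) (p k)) = smult L (\<Sum>k\<le>n. smult (b k) (p k))"
proof -
  interpret module_hom smult smult T by fact
  have "T (\<Sum>k\<le>n. smult (b k) (p k))
    = (\<Sum>k\<le>n. smult (b k * l k) (p k)) + (\<Sum>k\<le>n. \<Sum>r<k. smult (b k * G k r) (p r))"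
    by (simp add: sum scale Tp smult_add_right sum.distrib smult_sum_right)
  also have "(\<Sum>k\<le>n. \<Sum>r<k. smult (b k * G k r) (p r)) = (\<Sum>r\<le>n. \<Sum>k\<in>{r<..n}. smult (b k * G k r) (p r))"
    by (simp add: sum.Sigma, rule sum.reindex_bij_witness[of _ "\<lambda>(r, k). (k, r)" "\<lambda>(k, r). (r, k)"]) auto
  also have "(\<Sum>k\<le>n. smult (b k * l k) (p k)) + \<dots>
    = (\<Sum>r\<le>n. smult (b r * l r + (\<Sum>k\<in>{r<..n}. b k * G k r)) (p r))"
    by (simp add: sum.distrib smult_add_left smult_sum)
  also have "\<dots> = (\<Sum>r\<le>n. smult (L * b r) (p r))"
    using b by (intro sum.cong) auto
  finally show ?thesis by (simp add: smult_sum_right)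
qed

text \<open>Constants embed into polynomials by a ring homomorphism, which commutes with
  \<open>det\<close>. This serves the minors below the polynomial row of
  \<open>q_poly\<close>.\<close>

lemma det_const_polys:
  "det (mat n n (\<lambda>(i, j). [:f i j:])) = [:det (mat n n (\<lambda>(i, j). f i j)):]"
proof -
  interpret comm_ring_hom "\<lambda>c::'a::comm_ring_1. [:c:]"
    by unfold_locales (simp_all add: one_pCons)
  have "mat n n (\<lambda>(i, j). [:f i j:]) = map_mat (\<lambda>c. [:c:]) (mat n n (\<lambda>(i, j). f i j))"
    by (intro eq_matI) auto
  then show ?thesis by simp
qed

section \<open>Evaluation of the given functions at integers\<close>

context
  fixes m :: nat and \<epsilon> :: "nat \<Rightarrow> 'a::field_char_0 poly fract" and Y :: "nat \<Rightarrow> 'a poly"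
    and \<theta> :: "'a \<Rightarrow> 'a"
begin

text \<open>Rows count from 0, the given families from 1. Negative arguments are included because
  \<open>n - j\<close> may be negative in q_n.\<close>

definition eps_int :: "nat \<Rightarrow> int \<Rightarrow> 'a" where
  "eps_int a k = rf_eval (\<epsilon> (Suc a)) (of_int k)"

definition y_int :: "nat \<Rightarrow> int \<Rightarrow> 'a" where
  "y_int a k = poly (Y (Suc a)) (\<theta> (of_int k))"

lemma xi_of_int: "xi (\<epsilon> (Suc a)) (of_int k) (int i) = (\<Prod>q<i. eps_int a (k - int q))"
  by (simp add: xi_def eps_int_def)

lemma xi_Y_of_int:
  assumes "j \<le> m"
  shows "xi (\<epsilon> (Suc a)) (of_int (k - int j)) (int m - int j) * poly (Y (Suc a)) (\<theta> (of_int (k - int j)))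
    = col_entry eps_int y_int (k - int m) (k - int j) a"
proof -
  have "int m - int j = int (m - j)" using assms by simp
  moreover have "nat (k - int j - (k - int m)) = m - j" using assms by simp
  ultimately show ?thesis
    by (simp only: xi_of_int col_entry_def y_int_def)
qed

lemma Omega_mat_of_int: "Omega_mat m \<epsilon> Y \<theta> (of_int k) = casorati m eps_int y_int k"
proof (rule eq_matI)
  fix a c assume "a < dim_row (casorati m eps_int y_int k)" "c < dim_col (casorati m eps_int y_int k)"
  then have *: "a < m" "c < m" by (auto simp: casorati_def)
  then show "Omega_mat m \<epsilon> Y \<theta> (of_int k) $$ (a, c) = casorati m eps_int y_int k $$ (a, c)"
    using xi_Y_of_int[of "Suc c" a k]
    by (simp add: Omega_mat_def casorati_def algebra_simps)
qed (simp_all add: Omega_mat_def casorati_def)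

lemma M_fun_of_int:
  assumes a: "a < m"
  shows "M_fun m \<epsilon> Y \<theta> S (Suc a) (of_int k) = M_int m eps_int y_int (\<lambda>x. rf_eval S (of_int x)) a k"
proof -
  have xi_eq: "xi (\<epsilon> (Suc a)) (of_int k) (int m - int (Suc j)) = (\<Prod>q<m - 1 - j. eps_int a (k - int q))"
    if "j < m" for j
  proof -
    have "int m - int (Suc j) = int (m - 1 - j)" using that by simp
    then show ?thesis by (simp only: xi_of_int)
  qed
  have arg_eq: "(of_int k :: 'a) + of_nat (Suc j) = of_int (k + 1 + int j)" for j by simp
  have "M_fun m \<epsilon> Y \<theta> S (Suc a) (of_int k)
      = (\<Sum>j<m. (-1) ^ (Suc a + Suc j) * xi (\<epsilon> (Suc a)) (of_int k) (int m - int (Suc j))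
        * rf_eval S (of_int k + of_nat (Suc j))
        * det (mat_delete (Omega_mat m \<epsilon> Y \<theta> (of_int k + of_nat (Suc j))) a j))"
    unfolding M_fun_def by (rule sum.reindex_bij_witness[of _ Suc "\<lambda>j. j - 1"]) auto
  also have "\<dots> = (\<Sum>j<m. (-1) ^ (Suc a + Suc j) * (\<Prod>q<m - 1 - j. eps_int a (k - int q))
        * rf_eval S (of_int (k + 1 + int j)) * det (mat_delete (casorati m eps_int y_int (k + 1 + int j)) a j))"
    by (intro sum.cong refl) (simp only: Omega_mat_of_int lessThan_iff xi_eq arg_eq)
  finally show ?thesis
    by (simp add: M_int_def cofactor_def mult_ac)
qed

text \<open>The signs in the first row cancel those of the Laplace expansion, so the plain minors
  remain as coefficients.\<close>

lemma q_poly_expansion: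
  "q_poly m p \<epsilon> Y \<theta> n = (\<Sum>k\<le>n. smult (q_coeff m eps_int y_int n k) (p k))"
proof -
  let ?f = "\<lambda>l j. xi (\<epsilon> l) (of_nat n - of_nat j) (int m - int j) * poly (Y l) (\<theta> (of_nat n - of_nat j))"
  have minor: "det (mat m m (\<lambda>(a, c). [:?f (Suc a) (if c < j then c else Suc c):]))
    = [:casorati_minor m eps_int y_int (int n) j:]" if "j \<le> m" for j
  proof -
    have "?f (Suc a) i = col_entry eps_int y_int (int n - int m) (int n - int i) a" if "i \<le> m" for a i
      using xi_Y_of_int[OF that, of a "int n"] by simp
    then show ?thesis
      unfolding det_const_polys casorati_minor_def
      by (intro arg_cong[where f = "\<lambda>d. [:det d:]"] eq_matI) auto
  qed
  have "q_poly m p \<epsilon> Y \<theta> n = (\<Sum>j\<le>m. (-1) ^ j * ((-1) ^ j * (if j \<le> n then p (n - j) else 0))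
      * det (mat m m (\<lambda>(a, c). [:?f (Suc a) (if c < j then c else Suc c):])))"
    unfolding q_poly_def by (rule det_expand_first_row)
  also have "\<dots> = (\<Sum>j\<le>m. smult (casorati_minor m eps_int y_int (int n) j) (if j \<le> n then p (n - j) else 0))"
    by (intro sum.cong refl) (simp add: minor minus_one_power_iff)
  also have "\<dots> = (\<Sum>j\<in>{j. j \<le> m \<and> j \<le> n}. smult (casorati_minor m eps_int y_int (int n) j) (p (n - j)))"
    by (rule sum.mono_neutral_cong_right) auto
  also have "\<dots> = (\<Sum>k\<in>{k. k \<le> n \<and> n \<le> k + m}. smult (q_coeff m eps_int y_int n k) (p k))"
    by (rule sum.reindex_bij_witness[of _ "\<lambda>k. n - k" "\<lambda>j. n - j"]) (auto simp: q_coeff_def)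
  also have "\<dots> = (\<Sum>k\<le>n. smult (q_coeff m eps_int y_int n k) (p k))"
    by (rule sum.mono_neutral_left) (auto simp: q_coeff_def)
  finally show ?thesis .
qed

end

section \<open>The operator D_{q,S} and its eigenvalues\<close>

theorem theorem3p1:
  fixes A :: "('a::field_char_0 poly \<Rightarrow> 'a poly) set"
    and p :: "nat \<Rightarrow> 'a poly"
    and D\<^sub>p :: "'a poly \<Rightarrow> 'a poly"
    and \<theta> :: "'a \<Rightarrow> 'a"
    and m :: nat
    and \<epsilon> \<sigma> :: "nat \<Rightarrow> 'a poly fract"
    and \<D> :: "nat \<Rightarrow> 'a poly \<Rightarrow> 'a poly"
    and Y Mt :: "nat \<Rightarrow> 'a poly"
    and S :: "'a poly fract"
    and lam :: "'a \<Rightarrow> 'a"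
    and P\<^sub>S :: "'a poly"
  assumes alg: "operator_algebra A"
    and deg: "\<And>n. p n \<noteq> 0 \<and> degree (p n) = n"
    and Dp: "D\<^sub>p \<in> A"
    and eigen: "\<And>n. D\<^sub>p (p n) = smult (\<theta> (of_nat n)) (p n)"
    and m: "m \<ge> 1"
    and \<epsilon>_defined: "\<And>h k. h \<in> {1..m} \<Longrightarrow> k \<ge> 1 - int m \<Longrightarrow> rf_defined_at (\<epsilon> h) (of_int k)"
    and \<sigma>_defined: "\<And>h n. h \<in> {1..m} \<Longrightarrow> n \<ge> 1 \<Longrightarrow> rf_defined_at (\<sigma> h) (of_nat n)"
    and S_defined: "\<And>n. n \<ge> 1 \<Longrightarrow> rf_defined_at S (of_nat n)"
    and Dops: "\<And>h. h \<in> {1..m} \<Longrightarrow> is_D_operator A p (\<epsilon> h) (\<sigma> h) (\<D> h)"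
    and Omega_nz: "\<And>n::nat. Omega m \<epsilon> Y \<theta> (of_nat n) \<noteq> 0"
    and lam: "\<And>x. SOmega_defined_at m \<epsilon> S x \<Longrightarrow>
                lam x - lam (x - 1) = rf_eval S x * Omega m \<epsilon> Y \<theta> x"
    and i: "\<exists>R. \<forall>x. SOmega_defined_at m \<epsilon> S x \<longrightarrow>
                rf_eval S x * Omega m \<epsilon> Y \<theta> x = poly R x"
    and ii: "\<And>h x. h \<in> {1..m} \<Longrightarrow> M_defined_at m \<epsilon> S x \<Longrightarrow> rf_defined_at (\<sigma> h) (x + 1) \<Longrightarrow>
                M_fun m \<epsilon> Y \<theta> S h x = rf_eval (\<sigma> h) (x + 1) * poly (Mt h) (\<theta> x)"
    and iii: "\<And>x. M_defined_at m \<epsilon> S x \<Longrightarrow>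
                poly P\<^sub>S (\<theta> x) = 2 * lam x + (\<Sum>h=1..m. poly (Y h) (\<theta> x) * M_fun m \<epsilon> Y \<theta> S h x)"
  shows "\<exists>DqS\<in>A.
           (\<forall>n. DqS (q_poly m p \<epsilon> Y \<theta> n) = smult (lam (of_nat n)) (q_poly m p \<epsilon> Y \<theta> n)) \<and>
           DqS = (\<lambda>f. smult (1/2) (op_poly P\<^sub>S D\<^sub>p f)
                   + (\<Sum>h=1..m. op_poly (Mt h) D\<^sub>p (\<D> h (op_poly (Y h) D\<^sub>p f))))"
proof -
  let ?e = "eps_int \<epsilon>" and ?y = "y_int Y \<theta>" and ?s = "\<lambda>k. rf_eval S (of_int k)"
  define T where "T f = smult (1/2) (op_poly P\<^sub>S D\<^sub>p f)
      + (\<Sum>h=1..m. op_poly (Mt h) D\<^sub>p (\<D> h (op_poly (Y h) D\<^sub>p f)))" for f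
  define lm where "lm k = lam (of_nat k)" for k :: nat
  have D: "is_D_operator A p (\<epsilon> (Suc a)) (\<sigma> (Suc a)) (\<D> (Suc a))" if "a < m" for a
    using Dops that by simp
  have shift: "(\<Sum>h=1..m. f h) = (\<Sum>a<m. f (Suc a))" for f :: "nat \<Rightarrow> 'b::comm_monoid_add"
    by (rule sum.reindex_bij_witness[of _ Suc "\<lambda>h. h - 1"]) auto
  have "(\<lambda>f. op_poly (Mt h) D\<^sub>p (\<D> h (op_poly (Y h) D\<^sub>p f))) \<in> A" if "h \<in> {1..m}" for h
    by (rule op_alg_comp[OF alg op_alg_op_poly[OF alg Dp] op_alg_comp[OF alg _ op_alg_op_poly[OF alg Dp]]])
      (use Dops[OF that] in \<open>simp add: is_D_operator_def\<close>)
  then have T_in: "T \<in> A"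
    unfolding T_def[abs_def]
    by (rule op_alg_add[OF alg op_alg_smult[OF alg op_alg_op_poly[OF alg Dp]] op_alg_sum[OF alg]])
  have Dp_hom: "module_hom smult smult D\<^sub>p" using op_alg_linear alg Dp by blast
  have poly_eigen: "op_poly P D\<^sub>p (p n) = smult (poly P (\<theta> (of_nat n))) (p n)" for P n
    by (rule op_poly_eigen[OF Dp_hom eigen])
  \<comment> \<open>The arguments \<open>n - i\<close> are at least \<open>2 - m\<close>, within the
    range where the rational functions are assumed to be defined.\<close>
  have SO: "SOmega_defined_at m \<epsilon> S (of_nat n)" if "n \<ge> 1" for n
    unfolding SOmega_defined_at_def
  proof (intro conjI ballI)
    show "rf_defined_at S (of_nat n)" using S_defined that by simp
    fix l i assume "l \<in> {1..m}" "i \<in> {1..<m}"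
    then show "rf_defined_at (\<epsilon> l) (of_nat n - of_nat i)"
      using \<epsilon>_defined[of l "int n - int i"] that by simp
  qed
  have M_ok: "M_defined_at m \<epsilon> S (of_nat n)" for n
    unfolding M_defined_at_def using SO[of "n + _"] by auto
  have lm: "lm (Suc k) - lm k = ?s (int k + 1) * det (casorati m ?e ?y (int k + 1))" for k
    using lam[OF SO[of "Suc k"]] Omega_mat_of_int[of m \<epsilon> Y \<theta> "int k + 1"]
    by (simp add: lm_def Omega_def add.commute)
  have M: "M_int m ?e ?y ?s a (int k) = rf_eval (\<sigma> (Suc a)) (of_nat (Suc k)) * poly (Mt (Suc a)) (\<theta> (of_nat k))"
    if "a < m" for a k
    using ii[of "Suc a" "of_nat k"] M_ok \<sigma>_defined[of "Suc a" "Suc k"] that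
      M_fun_of_int[OF that, of \<epsilon> Y \<theta> S "int k"] by (simp add: add.commute)
  have PS: "poly P\<^sub>S (\<theta> (of_nat k)) = 2 * lm k + (\<Sum>a<m. ?y a (int k) * M_int m ?e ?y ?s a (int k))" for k
    using iii[OF M_ok, of k, unfolded shift] M_fun_of_int[of _ m \<epsilon> Y \<theta> S "int k"]
    by (simp add: lm_def y_int_def)
  \<comment> \<open>Each coefficient of the D-operator at \<open>p r\<close> carries the value of
    sigma at \<open>r + 1\<close>, and the outer polynomial contributes its value at theta_r; by
    (ii) their product is M_h at \<open>r\<close>. The same holds for \<open>r = k\<close>.\<close>
  have DY: "op_poly (Mt (Suc a)) D\<^sub>p (\<D> (Suc a) (op_poly (Y (Suc a)) D\<^sub>p (p k)))
    = smult (- (1/2) * (?y a (int k) * M_int m ?e ?y ?s a (int k))) (p k)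
      + (\<Sum>r<k. smult ((-1) ^ (k + r + 1) * (col_entry ?e ?y (int r) (int k) a * M_int m ?e ?y ?s a (int r))) (p r))"
    if a: "a < m" for a k
  proof -
    interpret D: module_hom smult smult "\<D> (Suc a)"
      using D[OF a] by (simp add: is_D_operator_def linear_iff_module_hom)
    interpret Mt: module_hom smult smult "op_poly (Mt (Suc a)) D\<^sub>p"
      using op_alg_linear[OF alg op_alg_op_poly[OF alg Dp]] .
    let ?c = "\<lambda>r. (-1) ^ (k + r + 1) * rf_eval (\<sigma> (Suc a)) (of_nat (Suc r))
      * (\<Prod>i<k - r. ?e a (int k - int i))"
    have D_eq: "\<D> (Suc a) (p k) = smult (- (1/2) * rf_eval (\<sigma> (Suc a)) (of_nat (Suc k))) (p k)
      + (\<Sum>r<k. smult (?c r) (p r))"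
    proof -
      have "(\<Sum>j=1..k. smult ((-1) ^ (j + 1) * rf_eval (\<sigma> (Suc a)) (of_nat (k - j + 1))
          * (\<Prod>i<j. rf_eval (\<epsilon> (Suc a)) (of_nat (k - i)))) (p (k - j))) = (\<Sum>r<k. smult (?c r) (p r))"
      \<comment> \<open>With \<open>r = k - j\<close> the sum \<open>k + r\<close> has the parity of
        \<open>j\<close>.\<close>
      proof (rule sum.reindex_bij_witness[of _ "\<lambda>r. k - r" "\<lambda>j. k - j"])
        fix j assume j: "j \<in> {1..k}"
        have "even (k + (k - j)) \<longleftrightarrow> even j" using j by simp
        then have "(-1 :: 'a) ^ (k + (k - j)) = (-1) ^ j" by (simp add: minus_one_power_iff)
        moreover have "(\<Prod>i<j. rf_eval (\<epsilon> (Suc a)) (of_nat (k - i))) = (\<Prod>i<j. ?e a (int k - int i))"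
          using j by (intro prod.cong) (auto simp: eps_int_def of_nat_diff)
        ultimately show "smult (?c (k - j)) (p (k - j))
          = smult ((-1) ^ (j + 1) * rf_eval (\<sigma> (Suc a)) (of_nat (k - j + 1))
            * (\<Prod>i<j. rf_eval (\<epsilon> (Suc a)) (of_nat (k - i)))) (p (k - j))"
          using j by simp
      qed auto
      then show ?thesis using D[OF a] by (simp add: is_D_operator_def)
    qed
    have lead: "?y a (int k) * (- (1/2) * rf_eval (\<sigma> (Suc a)) (of_nat (Suc k)) * poly (Mt (Suc a)) (\<theta> (of_nat k)))
      = - (1/2) * (?y a (int k) * M_int m ?e ?y ?s a (int k))"
      by (simp add: M[OF a])
    have low: "?y a (int k) * (?c r * poly (Mt (Suc a)) (\<theta> (of_nat r)))
      = (-1) ^ (k + r + 1) * (col_entry ?e ?y (int r) (int k) a * M_int m ?e ?y ?s a (int r))" if "r < k" for r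
    proof -
      have "nat (int k - int r) = k - r" using that by simp
      then show ?thesis by (simp add: M[OF a] col_entry_def)
    qed
    have "op_poly (Mt (Suc a)) D\<^sub>p (\<D> (Suc a) (op_poly (Y (Suc a)) D\<^sub>p (p k)))
      = smult (?y a (int k) * (- (1/2) * rf_eval (\<sigma> (Suc a)) (of_nat (Suc k)) * poly (Mt (Suc a)) (\<theta> (of_nat k)))) (p k)
        + (\<Sum>r<k. smult (?y a (int k) * (?c r * poly (Mt (Suc a)) (\<theta> (of_nat r)))) (p r))"
      by (simp only: poly_eigen D.scale D_eq Mt.scale Mt.add Mt.sum smult_add_right smult_sum_right smult_smult)
        (simp add: y_int_def mult.assoc)
    also have "\<dots> = smult (- (1/2) * (?y a (int k) * M_int m ?e ?y ?s a (int k))) (p k)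
      + (\<Sum>r<k. smult ((-1) ^ (k + r + 1) * (col_entry ?e ?y (int r) (int k) a * M_int m ?e ?y ?s a (int r))) (p r))"
      unfolding lead by (intro arg_cong2[where f = "(+)"] sum.cong refl) (simp only: low lessThan_iff)
    finally show ?thesis .
  qed
  have Tp: "T (p k) = smult (lm k) (p k) + (\<Sum>r<k. smult (lower_coeff m ?e ?y ?s k r) (p r))" for k
  proof -
    let ?d = "\<lambda>a. ?y a (int k) * M_int m ?e ?y ?s a (int k)"
    let ?g = "\<lambda>a r. (-1) ^ (k + r + 1) * (col_entry ?e ?y (int r) (int k) a * M_int m ?e ?y ?s a (int r))"
    have "T (p k) = smult (1/2 * poly P\<^sub>S (\<theta> (of_nat k))) (p k)
      + (\<Sum>a<m. smult (- (1/2) * ?d a) (p k) + (\<Sum>r<k. smult (?g a r) (p r)))"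
      unfolding T_def shift poly_eigen[of P\<^sub>S] smult_smult
      by (intro arg_cong2[where f = "(+)"] sum.cong refl) (simp only: DY lessThan_iff)
    also have "\<dots> = smult (1/2 * poly P\<^sub>S (\<theta> (of_nat k)) + (\<Sum>a<m. - (1/2) * ?d a)) (p k)
      + (\<Sum>r<k. smult (\<Sum>a<m. ?g a r) (p r))"
      unfolding sum.distrib smult_add_left smult_sum by (subst sum.swap) (simp only: add.assoc)
    \<comment> \<open>The factor -1/2 in the diagonal part of the D-operators cancels the sum over h
      in (iii), leaving the eigenvalue.\<close>
    also have "1/2 * poly P\<^sub>S (\<theta> (of_nat k)) + (\<Sum>a<m. - (1/2) * ?d a) = lm k"
      unfolding PS sum_distrib_left[symmetric] by (simp add: field_simps)
    also have "(\<lambda>r. \<Sum>a<m. ?g a r) = lower_coeff m ?e ?y ?s k"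
      by (simp add: lower_coeff_def fun_eq_iff sum_distrib_left)
    finally show ?thesis .
  qed
  have "T (q_poly m p \<epsilon> Y \<theta> n) = smult (lam (of_nat n)) (q_poly m p \<epsilon> Y \<theta> n)" for n
    unfolding q_poly_expansion lm_def[symmetric]
    by (rule triangular_eigenvector[OF op_alg_linear[OF alg T_in] Tp])
      (rule q_coeff_eigen[OF lm])
  then show ?thesis
    using T_in by (intro bexI[of _ T]) (auto simp: T_def)
qed

end
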